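(* Let $q,r,s\neq n$ be real numbers such that either $s<r<0<q<n$, or $0<s<r<q<n$, or $0<s<n<r<q$. Then for all $K\in\mathcal{S}_0$ $$\widetilde{G}^{orlicz}_r(K)\leq\big[\widetilde{G}^{orlicz}_q(K)\big]^{\frac{r-s}{q-s}}\big[\widetilde{G}^{orlicz}_s(K)\big]^{\frac{q-r}{q-s}}\quad\text{and}\quad \widetilde{\Omega}^{orlicz}_r(K)\leq\big[\widetilde{\Omega}^{orlicz}_q(K)\big]^{\frac{r-s}{q-s}}\big[\widetilde{\Omega}^{orlicz}_s(K)\big]^{\frac{q-r}{q-s}}.$$
   Context: $B_2^n$ is the closed unit Euclidean ball of $\mathbb{R}^n$, $S^{n-1}$ the unit sphere, $\sigma$ the spherical measure on $S^{n-1}$, $|\cdot|$ volume, $\omega_n=|B_2^n|$. A compact set $K$ that contains the closed segment from the origin to each of its points has radial function $\rho_K(u)=\max\{\lambda:\lambda u\in K\}$, $u\in S^{n-1}$; $K$ is a star body (about the origin) if $\rho_K$ is continuous and positive on $S^{n-1}$. $\mathcal{S}_0$ is the set of star bodies and $\mathcal{K}_0\subset\mathcal{S}_0$ the set of convex bodies with the origin in their interiors. For $K\in\mathcal{S}_0$ the polar body is $K^\circ=\{y:\langle x,y\rangle\leq1\ \forall x\in K\}$. $\mathcal{K}_c$ is the set of $K\in\mathcal{K}_0$ with centroid at the origin, $\mathcal{K}_s$ the set of $K\in\mathcal{K}_0$ with $K^\circ\in\mathcal{K}_c$; $\widetilde{\mathcal{K}}=\mathcal{K}_c\cup\mathcal{K}_s$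 and $\widetilde{\mathcal{S}}=\{L\in\mathcal{S}_0: L^\circ\in\widetilde{\mathcal{K}}\}$. The volume radius is $\mathrm{vrad}(K)=(|K|/\omega_n)^{1/n}$. For $p\in\mathbb{R}$ and $K,L\in\mathcal{S}_0$, $\widetilde{V}_p(K,L)=\frac1n\int_{S^{n-1}}\left(\frac{\rho_L(u)}{\rho_K(u)}\right)^p\rho_K(u)^n\,d\sigma(u)$. For $p\in(-\infty,0)\cup(n,\infty)$, $\widetilde{\Omega}_{p}^{orlicz}(K)=\inf_{L\in\widetilde{\mathcal{S}}}\{n\widetilde{V}_p(K,\mathrm{vrad}(L^\circ)L)\}$ and $\widetilde{G}_{p}^{orlicz}(K)=\inf_{L\in\widetilde{\mathcal{K}}}\{n\widetilde{V}_p(K,\mathrm{vrad}(L^\circ)L)\}$. For $p\in(0,n)$ they are defined by the same formulas with $\sup$ in place of $\inf$. *)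

theory Defs
  imports "HOL-Analysis.Analysis"
begin

(* n is CARD('n) throughout. *)

(* The surface measure on the unit sphere: the measure of A is n times the volume of the
   cone {t u | 0 < t \<le> 1, u \<in> A}; the total mass is n * omega_n. *)
definition spherical_measure :: "(real ^ 'n) measure" where
  "spherical_measure =
     scale_measure (of_nat CARD('n))
       (distr (restrict_space lborel (cball 0 1 - {0})) (restrict_space borel (sphere 0 1))
          (\<lambda>x. x /\<^sub>R norm x))"

lemma spherical_projection_measurable:
  "(\<lambda>x::real ^ 'n. x /\<^sub>R norm x)
     \<in> restrict_space lborel (cball 0 1 - {0}) \<rightarrow>\<^sub>M restrict_space borel (sphere 0 1)"
  by (rule measurable_restrict_space3) auto

lemma emeasure_spherical_measure:
  fixes A :: "(real ^ 'n) set"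
  assumes "A \<in> sets borel" "A \<subseteq> sphere 0 1"
  shows "emeasure spherical_measure A =
           of_nat CARD('n) * emeasure lborel {t *\<^sub>R u |t u. 0 < t \<and> t \<le> 1 \<and> u \<in> A}"
proof -
  let ?M = "restrict_space lborel (cball 0 1 - {0}) :: (real ^ 'n) measure"
  let ?C = "{t *\<^sub>R u |t u. 0 < t \<and> t \<le> 1 \<and> u \<in> A}"
  have A: "A \<in> sets (restrict_space borel (sphere 0 1))"
    using assms by (auto simp: sets_restrict_space)
  have C: "(\<lambda>x. x /\<^sub>R norm x) -` A \<inter> space ?M = ?C" (is "?B = _")
  proof (intro equalityI subsetI)
    fix x assume "x \<in> ?B"
    then have "x = norm x *\<^sub>R (x /\<^sub>R norm x)" "0 < norm x" "norm x \<le> 1" "x /\<^sub>R norm x \<in> A"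
      by (auto simp: space_restrict_space)
    then show "x \<in> ?C" by blast
  next
    fix x assume "x \<in> ?C"
    then obtain t u where tu: "x = t *\<^sub>R u" "0 < t" "t \<le> 1" "u \<in> A" by blast
    then have "norm u = 1" using assms(2) by auto
    with tu show "x \<in> ?B" by (auto simp: space_restrict_space)
  qed
  have "emeasure (distr ?M (restrict_space borel (sphere 0 1)) (\<lambda>x. x /\<^sub>R norm x)) A
          = emeasure ?M ?C"
    by (simp only: emeasure_distr[OF spherical_projection_measurable A] C)
  also have "\<dots> = emeasure lborel ?C"
    by (rule emeasure_restrict_space) (auto simp flip: C simp: space_restrict_space)
  finally show ?thesis by (simp add: spherical_measure_def)
qed

(* The maximum of {l. l u \<in> K}; it exists for nonempty K as in star_bodies below. *)
definition radial :: "(real ^ 'n) set \<Rightarrow> real ^ 'n \<Rightarrow> real" where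
  "radial K u = (GREATEST l. l *\<^sub>R u \<in> K)"

(* Nonemptiness is explicit: the segment condition holds vacuously for the empty set, whose
   radial function would be an unspecified value. *)
definition star_bodies :: "(real ^ 'n) set set" where
  "star_bodies = {K. compact K \<and> K \<noteq> {} \<and> (\<forall>x\<in>K. closed_segment 0 x \<subseteq> K) \<and>
     continuous_on (sphere 0 1) (radial K) \<and> (\<forall>u\<in>sphere 0 1. 0 < radial K u)}"

definition convex_bodies :: "(real ^ 'n) set set" where
  "convex_bodies = {K. compact K \<and> convex K \<and> 0 \<in> interior K}"

definition polar :: "(real ^ 'n) set \<Rightarrow> (real ^ 'n) set" where
  "polar K = {y. \<forall>x\<in>K. x \<bullet> y \<le> 1}"

definition centroid :: "(real ^ 'n) set \<Rightarrow> real ^ 'n" where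
  "centroid K = (LINT x:K|lborel. x) /\<^sub>R measure lborel K"

definition centered_bodies :: "(real ^ 'n) set set" where
  "centered_bodies = {K \<in> convex_bodies. centroid K = 0}"

definition santalo_bodies :: "(real ^ 'n) set set" where
  "santalo_bodies = {K \<in> convex_bodies. polar K \<in> centered_bodies}"

definition K_tilde :: "(real ^ 'n) set set" where
  "K_tilde = centered_bodies \<union> santalo_bodies"

definition S_tilde :: "(real ^ 'n) set set" where
  "S_tilde = {L \<in> star_bodies. polar L \<in> K_tilde}"

definition vrad :: "(real ^ 'n) set \<Rightarrow> real" where
  "vrad K =
     (measure lborel K / measure lborel (cball 0 1 :: (real ^ 'n) set)) powr (1 / real CARD('n))"

definition dual_mixed_volume :: "real \<Rightarrow> (real ^ 'n) set \<Rightarrow> (real ^ 'n) set \<Rightarrow> real" where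
  "dual_mixed_volume p K L = 1 / real CARD('n) *
     (LINT u|spherical_measure. (radial L u / radial K u) powr p * radial K u ^ CARD('n))"

(* The common shape of the two functionals, over a class \<C> of bodies. For K a star body and \<C>
   either K_tilde or S_tilde, the values are nonnegative; for 0 < p < n they are also bounded
   above, by Hoelder's inequality together with the Blaschke-Santalo inequality, so the real
   supremum is the true one. The exponents p = 0 and p = n are left undefined. *)
definition orlicz_extremum :: "(real ^ 'n) set set \<Rightarrow> real \<Rightarrow> (real ^ 'n) set \<Rightarrow> real" where
  "orlicz_extremum \<C> p K =
     (if p < 0 \<or> real CARD('n) < p then
        INF L\<in>\<C>. real CARD('n) * dual_mixed_volume p K ((*\<^sub>R) (vrad (polar L)) ` L)
      else if 0 < p \<and> p < real CARD('n) then
        SUP L\<in>\<C>. real CARD('n) * dual_mixed_volume p K ((*\<^sub>R) (vrad (polar L)) ` L)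
      else undefined)"

definition Omega_orlicz :: "real \<Rightarrow> (real ^ 'n) set \<Rightarrow> real" where
  "Omega_orlicz p K = orlicz_extremum S_tilde p K"

definition G_orlicz :: "real \<Rightarrow> (real ^ 'n) set \<Rightarrow> real" where
  "G_orlicz p K = orlicz_extremum K_tilde p K"

end

theory Submission
  imports Defs
begin

text \<open>
  For a fixed competitor L, Hoelder's inequality makes the normalized dual mixed volume a
  log-convex function of the exponent; taking the infimum or supremum over L gives the theorem, as
  soon as the suprema (exponents in (0, n)) are finite. For that, \<open>t powr p \<le> 1 + t ^ n\<close> reduces the
  claim to a bound, with any constant, for the volume product of L and its polar. Passing to
  bipolars, one may assume that L has its centroid at 0. Let the rows of A be points of L that
  maximize \<open>\<bar>det A\<bar>\<close>. By Cramer's rule L lies in the parallelepiped spanned by these rows with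
  coefficients in [-1, 1]. Since the centroid is 0, the inner products of points of L and of its
  polar are bounded below, so A maps the polar into a cube. The determinants cancel in the product.
\<close>

subsection \<open>Volumes of linear images\<close>

text \<open>Translating the box along coordinate \<open>n\<close> makes its lower bound there
  nonnegative, as \<open>measure_shear_interval\<close> demands. The shear is additive, so the image
  of the box is merely translated as well.\<close>

lemma measure_shear_cbox:
  fixes a b :: "real ^ 'n"
  assumes "m \<noteq> n"
  shows "measure lebesgue ((\<lambda>x. \<chi> i. if i = m then x $ m + x $ n else x $ i) ` cbox a b)
    = measure lebesgue (cbox a b)" (is "measure lebesgue (?h ` _) = _")
proof (cases "cbox a b = {}")
  case False
  define w :: "real ^ 'n" where "w = axis n \<bar>a $ n\<bar>"
  have "?h (w + x) = ?h w + ?h x" for x by (simp add: vec_eq_iff)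
  then have "(+) (?h w) ` ?h ` cbox a b = ?h ` cbox (w + a) (w + b)"
    unfolding cbox_translation image_image by simp
  then have "measure lebesgue (?h ` cbox a b) = measure lebesgue (?h ` cbox (w + a) (w + b))"
    using measure_translation[of "?h w" "?h ` cbox a b"] by simp
  also have "\<dots> = measure lebesgue (cbox (w + a) (w + b))"
    using assms False by (intro measure_shear_interval) (auto simp: w_def cbox_translation)
  also have "\<dots> = measure lebesgue (cbox a b)"
    unfolding cbox_translation by (rule measure_translation)
  finally show ?thesis .
qed simp

text \<open>The swap is an involution that sends boxes to boxes, and the product of the side lengths
  is invariant under reindexing by a transposition.\<close>

lemma measure_swap_cbox:
  fixes a b :: "real ^ 'n"
  shows "measure lebesgue ((\<lambda>x. \<chi> i. x $ Transposition.transpose m n i) ` cbox a b)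
    = measure lebesgue (cbox a b)" (is "measure lebesgue (?h ` _) = _")
proof -
  have inv: "?h (?h x) = x" for x :: "real ^ 'n" by (simp add: vec_eq_iff)
  have mem: "?h x \<in> cbox (?h a) (?h b)" if "x \<in> cbox a b" for a b x :: "real ^ 'n"
    using that by (simp add: mem_box_cart)
  have eq: "?h ` cbox a b = cbox (?h a) (?h b)"
  proof (intro equalityI subsetI)
    fix x assume "x \<in> cbox (?h a) (?h b)"
    from mem[OF this] have "?h x \<in> cbox a b" by (simp only: inv)
    then show "x \<in> ?h ` cbox a b" using inv[of x, symmetric] by (rule rev_image_eqI)
  qed (use mem in blast)
  show ?thesis
  proof (cases "cbox a b = {}")
    case False
    then have "cbox (?h a) (?h b) \<noteq> {}" unfolding eq[symmetric] by blast
    moreover have "(\<Prod>i\<in>UNIV. (b - a) $ Transposition.transpose m n i) = (\<Prod>i\<in>UNIV. (b - a) $ i)"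
      by (rule prod.reindex_bij_betw[OF bij_transpose])
    ultimately show ?thesis using False unfolding eq by (simp add: content_cbox_cart)
  qed simp
qed

text \<open>The library's \<open>measure_linear_image\<close> requires a well-ordered index type.\<close>

lemma linear_image_lmeasurable_and_measure:
  fixes f :: "real ^ 'n \<Rightarrow> real ^ 'n"
  assumes "linear f"
  shows "\<forall>S\<in>lmeasurable. f ` S \<in> lmeasurable \<and>
    measure lebesgue (f ` S) = \<bar>det (matrix f)\<bar> * measure lebesgue S" (is "?P f")
proof -
  \<comment> \<open>For a linear map with determinant of absolute value 1 it suffices that the
    volumes of boxes are preserved; swaps and shears are treated this way.\<close>
  have box: "?P h" if "linear h" "\<bar>det (matrix h)\<bar> = 1"
    "\<And>a b. measure lebesgue (h ` cbox a b) = measure lebesgue (cbox a b)" for h :: "real ^ 'n \<Rightarrow> real ^ 'n"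
    using measure_linear_sufficient[OF that(1), of _ 1] unfolding that(2,3) by (metis mult_1)
  show ?thesis
  \<comment> \<open>Every linear map is composed of maps with a vanishing coordinate, diagonal maps,
    coordinate swaps and shears.\<close>
  proof (rule induct_linear_elementary[OF assms])
    fix f g :: "real ^ 'n \<Rightarrow> real ^ 'n"
    assume fg: "linear f" "linear g" "?P f" "?P g"
    show "?P (f \<circ> g)"
    proof
      fix S :: "(real ^ 'n) set" assume "S \<in> lmeasurable"
      moreover have "(f \<circ> g) ` S = f ` g ` S" by (rule image_comp[symmetric])
      ultimately show "(f \<circ> g) ` S \<in> lmeasurable \<and>
          measure lebesgue ((f \<circ> g) ` S) = \<bar>det (matrix (f \<circ> g))\<bar> * measure lebesgue S"
        using fg(3,4) matrix_compose[OF fg(2,1)]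
        by (simp add: det_mul abs_mult del: image_comp)
    qed
  next
    fix f :: "real ^ 'n \<Rightarrow> real ^ 'n" and i
    assume f: "linear f" "\<And>x. f x $ i = 0"
    \<comment> \<open>A map with a vanishing coordinate is not onto, hence not injective: its
      determinant is 0 and its images are negligible, so both volumes are 0.\<close>
    have "\<not> surj f"
    proof
      assume "surj f"
      then obtain x where "(\<chi> i. 1) = f x" by (rule surjE)
      from arg_cong[OF this, of "\<lambda>y. y $ i"] show False using f(2) by simp
    qed
    then have "\<not> inj f" using f(1) linear_injective_imp_surjective by blast
    then have "det (matrix f) = 0" "\<And>S. negligible (f ` S)"
      using det_nz_iff_inj[OF f(1)] negligible_linear_singular_image[OF f(1)] by auto
    then show "?P f" by (auto simp: negligible_iff_measure)
  next
    fix c :: "'n \<Rightarrow> real"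
    show "?P (\<lambda>x. \<chi> i. c i * x $ i)"
      by (simp add: measurable_stretch measure_stretch axis_def matrix_def det_diagonal)
  next
    fix m n :: 'n
    let ?h = "\<lambda>x::real ^ 'n. \<chi> i. x $ Transposition.transpose m n i"
    have "matrix ?h = (\<chi> i. mat 1 $ Transposition.transpose m n i)"
      by (auto simp: matrix_def axis_def mat_def vec_eq_iff)
    then have "\<bar>det (matrix ?h)\<bar> = 1"
      by (simp add: det_permute_rows permutes_swap_id sign_def)
    moreover have "linear ?h" by (rule linearI) (simp_all add: vec_eq_iff)
    ultimately show "?P ?h" using measure_swap_cbox by (intro box)
  next
    fix m n :: 'n assume mn: "m \<noteq> n"
    let ?h = "\<lambda>x::real ^ 'n. \<chi> i. if i = m then x $ m + x $ n else x $ i"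
    have "matrix ?h = (\<chi> k. if k = m then row m (mat 1) + 1 *s row n (mat 1) else row k (mat 1))"
      by (auto simp: matrix_def axis_def mat_def row_def vec_eq_iff)
    then have "\<bar>det (matrix ?h)\<bar> = 1"
      by (simp only: det_row_operation[OF mn]) simp
    moreover have "linear ?h" by (rule linearI) (auto simp: vec_eq_iff algebra_simps)
    ultimately show "?P ?h" using measure_shear_cbox[OF mn] by (intro box)
  qed
qed

lemma matrix_image_lmeasurable:
  fixes A :: "real ^ 'n ^ 'n"
  shows "S \<in> lmeasurable \<Longrightarrow> (*v) A ` S \<in> lmeasurable"
  using linear_image_lmeasurable_and_measure[OF matrix_vector_mul_linear] by blast

lemma measure_matrix_image:
  fixes A :: "real ^ 'n ^ 'n"
  shows "S \<in> lmeasurable \<Longrightarrow> measure lebesgue ((*v) A ` S) = \<bar>det A\<bar> * measure lebesgue S"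
  using linear_image_lmeasurable_and_measure[OF matrix_vector_mul_linear[of A]] by simp

subsection \<open>Hoelder's inequality\<close>

text \<open>Hoelder's inequality with conjugate exponents 1/a and 1/b: Young's inequality is applied
  pointwise to f/F and g/G and then integrated. If F or G is 0, the corresponding function vanishes
  almost everywhere, and so does the product.\<close>

lemma integral_powr_mult_le:
  fixes f g :: "'a \<Rightarrow> real"
  assumes f: "integrable M f" "\<And>x. x \<in> space M \<Longrightarrow> 0 \<le> f x" and g: "integrable M g" "\<And>x. x \<in> space M \<Longrightarrow> 0 \<le> g x"
    and ab: "0 < a" "0 < b" "a + b = 1"
  shows "(LINT x|M. f x powr a * g x powr b) \<le> (LINT x|M. f x) powr a * (LINT x|M. g x) powr b"
proof -
  define F where "F = (LINT x|M. f x)"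
  define G where "G = (LINT x|M. g x)"
  have "F \<ge> 0" "G \<ge> 0" unfolding F_def G_def using f g by (auto intro!: Bochner_Integration.integral_nonneg)
  consider "F = 0" | "G = 0" | "F > 0" "G > 0" using \<open>F \<ge> 0\<close> \<open>G \<ge> 0\<close> by linarith
  then show ?thesis
  proof cases
    case 1
    then have "AE x in M. f x = 0"
      using integral_nonneg_eq_0_iff_AE[OF f(1)] f(2) by (simp add: F_def AE_I2)
    then have "AE x in M. f x powr a * g x powr b = 0" by eventually_elim simp
    then have "(LINT x|M. f x powr a * g x powr b) = 0" by (rule integral_eq_zero_AE)
    then show ?thesis by simp
  next
    case 2
    then have "AE x in M. g x = 0"
      using integral_nonneg_eq_0_iff_AE[OF g(1)] g(2) by (simp add: G_def AE_I2)
    then have "AE x in M. f x powr a * g x powr b = 0" by eventually_elim simp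
    then have "(LINT x|M. f x powr a * g x powr b) = 0" by (rule integral_eq_zero_AE)
    then show ?thesis by simp
  next
    case 3
    let ?c = "F powr a * G powr b"
    have "f x powr a * g x powr b \<le> ?c * (a * (f x / F) + b * (g x / G))" if x: "x \<in> space M" for x
    proof (cases "f x = 0 \<or> g x = 0")
      case True
      then show ?thesis using 3 ab f(2)[OF x] g(2)[OF x] by auto
    next
      case False
      then have "(f x / F) powr a * (g x / G) powr b \<le> a * (f x / F) + b * (g x / G)"
        using 3 ab f(2)[OF x] g(2)[OF x] by (intro Youngs_inequality_0) auto
      then show ?thesis using 3 f(2)[OF x] g(2)[OF x] by (simp add: powr_divide field_simps)
    qed
    \<comment> \<open>A non-integrable left integrand would have integral 0 by default, so an
      integrable nonnegative majorant suffices here.\<close>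
    then have "(LINT x|M. f x powr a * g x powr b)
        \<le> (LINT x|M. ?c * (a * (f x / F) + b * (g x / G)))"
      using 3 ab f g by (intro integral_mono') (auto intro!: add_nonneg_nonneg mult_nonneg_nonneg)
    also have "\<dots> = ?c * (a * (F / F) + b * (G / G))"
      using f(1) g(1) by (simp add: F_def G_def)
    also have "\<dots> = ?c" using 3 ab by simp
    finally show ?thesis by (simp add: F_def G_def)
  qed
qed

subsection \<open>The volume product\<close>

text \<open>Halving M towards x gives a copy inside M of volume \<open>2 ^ - n\<close> times that of M, on which
  the functional \<open>z \<mapsto> z \<bullet> y\<close> is very negative if \<open>x \<bullet> y\<close> is; on the rest of M it is at most 1.\<close>

lemma inner_ge_if_mem_polar_centered:
  fixes M :: "(real ^ 'n) set"
  assumes M: "M \<in> centered_bodies" and x: "x \<in> M" and y: "y \<in> polar M"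
  shows "x \<bullet> y \<ge> - (2 ^ (CARD('n) + 1))"
proof -
  have cM: "compact M" "convex M" "0 \<in> interior M" and c0: "centroid M = 0"
    using M by (auto simp: centered_bodies_def convex_bodies_def)
  define M' where "M' = (\<lambda>z. (1/2) *\<^sub>R z + (1/2) *\<^sub>R x) ` M"
  have cM': "compact M'" unfolding M'_def
    by (intro compact_continuous_image cM continuous_intros)
  have sub: "M' \<subseteq> M"
    unfolding M'_def using convexD[OF cM(2) _ x, of _ "1/2" "1/2"] by auto
  have borel: "M \<in> sets borel" "M' \<in> sets borel"
    using cM cM' by (auto intro: borel_compact)
  define \<mu> where "\<mu> = measure lborel M"
  have \<mu>: "measure lebesgue M = \<mu>" unfolding \<mu>_def using borel by (simp add: measure_completion)
  have "measure lborel M' = measure lebesgue M'" using borel by (simp add: measure_completion)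
  also have "\<dots> = \<mu> / 2 ^ CARD('n)"
    using measure_lebesgue_affine[of "1/2" "(1/2) *\<^sub>R x" M]
    by (simp add: M'_def \<mu> power_divide)
  finally have \<mu>': "measure lborel M' = \<mu> / 2 ^ CARD('n)" .
  \<comment> \<open>Positivity of the volume serves twice: the centroid is a quotient by it, so the
    integral itself must vanish; and it is cancelled at the end.\<close>
  obtain e where e: "e > 0" "ball 0 e \<subseteq> M" using cM(3) by (auto simp: mem_interior)
  have fin: "emeasure lborel M < \<infinity>" "emeasure lborel M' < \<infinity>"
    by (intro emeasure_bounded_finite compact_imp_bounded cM cM')+
  have "0 < measure lborel (ball (0::real^'n) e)" using e by (simp add: content_ball_pos)
  also have "\<dots> \<le> \<mu>" unfolding \<mu>_def
    using e fin borel by (intro measure_mono_fmeasurable) (auto simp: fmeasurable_def)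
  finally have \<mu>pos: "\<mu> > 0" .
  have int: "integrable lborel (\<lambda>z. indicator M z *\<^sub>R z)"
    using borel_integrable_compact[OF cM(1) continuous_on_id] by simp
  have z: "(LINT z|lborel. indicator M z *\<^sub>R z) = 0"
    using c0 \<mu>pos unfolding centroid_def \<mu>_def[symmetric] set_lebesgue_integral_def by simp
  define t where "t = - (x \<bullet> y)"
  have "0 = (LINT z|lborel. indicator M z *\<^sub>R z) \<bullet> y" by (simp add: z)
  also have "\<dots> = (LINT z|lborel. (indicator M z *\<^sub>R z) \<bullet> y)"
    using int by (simp only: integral_inner_left)
  \<comment> \<open>On \<open>M'\<close> the point z is the midpoint of some u in M and x, so
    \<open>z \<bullet> y\<close> is at most (1 - t)/2 = 1 - (1 + t)/2. On the rest of M the bound is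
    1, and outside M both sides are 0.\<close>
  also have "\<dots> \<le> (LINT z|lborel. indicator M z - (1 + t) / 2 * indicator M' z)"
  proof (rule integral_mono)
    fix z
    have 1: "u \<bullet> y \<le> 1" if "u \<in> M" for u using y that by (auto simp: polar_def)
    show "(indicator M z *\<^sub>R z) \<bullet> y \<le> indicator M z - (1 + t) / 2 * indicator M' z"
    proof (cases "z \<in> M'")
      case True
      then obtain u where u: "u \<in> M" "z = (1/2) *\<^sub>R u + (1/2) *\<^sub>R x" by (auto simp: M'_def)
      have "z \<in> M" using True sub by blast
      with True show ?thesis using 1[OF u(1)] by (simp add: u(2) t_def inner_simps field_simps)
    next
      case False
      then show ?thesis using 1[of z] by (auto simp: indicator_def)
    qed
  next
    show "integrable lborel (\<lambda>z. (indicator M z *\<^sub>R z) \<bullet> y)" by (rule integrable_inner_left[OF int])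
  qed (use borel fin in auto)
  also have "\<dots> = \<mu> - (1 + t) / 2 * (\<mu> / 2 ^ CARD('n))"
    using borel fin by (simp add: \<mu>_def[symmetric] \<mu>')
  finally have "(1 + t) / 2 * (\<mu> / 2 ^ CARD('n)) \<le> \<mu>" by simp
  then have "\<mu> * (1 + t) \<le> \<mu> * 2 ^ (CARD('n) + 1)" by (simp add: field_simps)
  then have "1 + t \<le> 2 ^ (CARD('n) + 1)" using \<mu>pos by (simp only: mult_le_cancel_left_pos)
  then show ?thesis by (simp add: t_def)
qed

text \<open>Supplies the compact set of matrices on which the determinant is maximized: it is an
  intersection of preimages of L under the row projections, and the norm of a matrix is at most the
  sum of the norms of its rows.\<close>

lemma compact_matrices_rows:
  fixes L :: "(real ^ 'n) set"
  assumes "compact L"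
  shows "compact {A :: real ^ 'n ^ 'm. \<forall>i. A $ i \<in> L}"
proof -
  have "closed {A :: real ^ 'n ^ 'm. \<forall>i. A $ i \<in> L}"
  proof -
    have "{A :: real ^ 'n ^ 'm. \<forall>i. A $ i \<in> L} = (\<Inter>i. (\<lambda>A. A $ i) -` L)" by auto
    then show ?thesis
      by (auto intro!: closed_INT closed_vimage continuous_intros compact_imp_closed[OF assms] )
  qed
  moreover obtain B where B: "\<And>x. x \<in> L \<Longrightarrow> norm x \<le> B"
    using compact_imp_bounded[OF assms] by (auto simp: bounded_iff)
  have "norm A \<le> (\<Sum>i\<in>(UNIV::'m set). B)" if "\<forall>i. A $ i \<in> L" for A :: "real ^ 'n ^ 'm"
    unfolding norm_vec_def[of A] using that B by (intro order.trans[OF L2_set_le_sum] sum_mono) auto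
  then have "bounded {A :: real ^ 'n ^ 'm. \<forall>i. A $ i \<in> L}"
    unfolding bounded_iff by blast
  ultimately show ?thesis by (simp add: compact_eq_bounded_closed)
qed

lemma closed_polar: "closed (polar L)"
proof -
  have "polar L = (\<Inter>x\<in>L. {y. x \<bullet> y \<le> 1})" by (auto simp: polar_def)
  then show ?thesis by (auto intro!: closed_INT closed_halfspace_le)
qed

text \<open>A point y of the polar, rescaled to length e, lies in L and has inner product e times
  \<open>norm y\<close> with y. Hence the polar lies in the ball of radius 1/e.\<close>

lemma compact_polar:
  assumes "e > 0" "cball 0 e \<subseteq> L"
  shows "compact (polar L)"
proof -
  have "norm y \<le> 1 / e" if y: "y \<in> polar L" for y
  proof (cases "y = 0")
    case False
    have "((e / norm y) *\<^sub>R y) \<in> L" using assms False by (intro subsetD[OF assms(2)]) auto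
    then have "((e / norm y) *\<^sub>R y) \<bullet> y \<le> 1" using y by (auto simp: polar_def)
    moreover have "((e / norm y) *\<^sub>R y) \<bullet> y = e * norm y"
      using False by (simp add: dot_square_norm power2_eq_square)
    ultimately show ?thesis using assms by (simp add: field_simps)
  qed (use assms in auto)
  then have "bounded (polar L)" by (auto simp: bounded_iff)
  then show ?thesis using closed_polar compact_eq_bounded_closed by blast
qed

text \<open>A crude form of the Blaschke-Santalo inequality. The constant is the product of the
  volumes of two cubes, with sides 2 and \<open>2 * 2 ^ (n + 1)\<close>.\<close>

lemma volume_product_centered_le:
  fixes M :: "(real ^ 'n) set"
  assumes M: "M \<in> centered_bodies"
  shows "measure lborel M * measure lborel (polar M) \<le> (2 ^ (CARD('n) + 3)) ^ CARD('n)"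
proof -
  have cM: "compact M" "convex M" "0 \<in> interior M"
    using M by (auto simp: centered_bodies_def convex_bodies_def)
  obtain e where e: "e > 0" "cball 0 e \<subseteq> M" using cM(3) by (auto simp: mem_interior_cball)
  have cP: "compact (polar M)" using compact_polar[OF e] .
  define S where "S = {A :: real ^ 'n ^ 'n. \<forall>i. A $ i \<in> M}"
  \<comment> \<open>The rows of \<open>mat e\<close> lie in the inscribed ball, and its determinant
    \<open>e ^ n\<close> is positive; hence the maximizing matrix A is invertible.\<close>
  have S0: "mat e \<in> S"
    unfolding S_def
  proof (safe, rule subsetD[OF e(2)])
    fix i :: 'n
    have "mat e $ i = e *\<^sub>R axis i (1::real)" by (simp add: vec_eq_iff mat_def axis_def)
    then show "mat e $ i \<in> cball 0 e" using e by simp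
  qed
  have "continuous_on S (\<lambda>A. \<bar>det A\<bar>)" unfolding det_def by (intro continuous_intros)
  moreover have "compact S" unfolding S_def by (rule compact_matrices_rows[OF cM(1)])
  ultimately have "\<exists>A\<in>S. \<forall>B\<in>S. \<bar>det B\<bar> \<le> \<bar>det A\<bar>"
    using S0 by (intro continuous_attains_sup) auto
  then obtain A where A: "A \<in> S" and max: "\<And>B. B \<in> S \<Longrightarrow> \<bar>det B\<bar> \<le> \<bar>det A\<bar>" by auto
  have "det (mat e :: real ^ 'n ^ 'n) = e ^ CARD('n)"
    by (subst det_diagonal) (auto simp: mat_def)
  then have D: "\<bar>det A\<bar> > 0" using max[OF S0] e(1) zero_less_power[OF e(1), of "CARD('n)"] by linarith
  have meas: "measure lborel X = measure lebesgue X" "X \<in> lmeasurable" if "compact X"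
    for X :: "(real ^ 'n) set"
    using that by (auto simp: measure_completion borel_compact lmeasurable_compact)
  have image: "(*v) B ` X \<in> lmeasurable" if "compact X"
    for B :: "real ^ 'n ^ 'n" and X :: "(real ^ 'n) set"
    by (intro matrix_image_lmeasurable lmeasurable_compact that)
  let ?Q = "\<lambda>c::real. cbox (\<chi> i. - c) (\<chi> i. c) :: (real ^ 'n) set"
  have Q: "measure lebesgue (?Q c) = (2 * c) ^ CARD('n)" if "c > 0" for c
    using that content_cbox_cart[of "\<chi> i. - c" "(\<chi> i. c) :: real ^ 'n"]
    by (auto simp: interval_eq_empty_cart)
  have "M \<subseteq> (*v) (transpose A) ` ?Q 1"
  proof
    fix x assume x: "x \<in> M"
    have "invertible (transpose A)" using D by (simp add: invertible_det_nz)
    then obtain c where xc: "x = transpose A *v c"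
      by (metis invertible_def matrix_vector_mul_assoc matrix_vector_mul_lid)
    have "\<bar>c $ k\<bar> \<le> 1" for k
    proof -
      \<comment> \<open>Replacing row k of A by x multiplies the determinant by \<open>c $ k\<close>
        and stays in S, so maximality bounds this coefficient by 1 in absolute value.\<close>
      have "x = (\<Sum>i\<in>UNIV. c $ i *s row i A)"
        using xc by (simp add: matrix_mult_sum row_def column_def transpose_def)
      then have "det (\<chi> i. if i = k then x else row i A) = c $ k * det A"
        by (simp only: cramer_lemma_transpose)
      moreover have "(\<chi> i. if i = k then x else row i A) \<in> S"
        using A x by (auto simp: S_def row_def)
      ultimately have "\<bar>c $ k\<bar> * \<bar>det A\<bar> \<le> \<bar>det A\<bar>" using max by (metis abs_mult)
      then show ?thesis using D by simp
    qed
    then have "c \<in> ?Q 1" by (auto simp: mem_box_cart abs_le_iff minus_le_iff)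
    then show "x \<in> (*v) (transpose A) ` ?Q 1" using xc by blast
  qed
  then have "measure lebesgue M \<le> measure lebesgue ((*v) (transpose A) ` ?Q 1)"
    by (intro measure_mono_fmeasurable image compact_cbox fmeasurableD[OF meas(2)] cM)
  also have "\<dots> = \<bar>det (transpose A)\<bar> * measure lebesgue (?Q 1)"
    by (intro measure_matrix_image lmeasurable_compact compact_cbox)
  also have "\<dots> = \<bar>det A\<bar> * 2 ^ CARD('n)"
    by (simp only: Q[OF zero_less_one] det_transpose mult_1_right)
  finally have 1: "measure lborel M \<le> \<bar>det A\<bar> * 2 ^ CARD('n)"
    by (simp only: meas(1)[OF cM(1)])
  define C where "C = (2::real) ^ (CARD('n) + 1)"
  have C: "C \<ge> 1" by (simp add: C_def del: power_Suc)
  have sub: "(*v) A ` polar M \<subseteq> ?Q C"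
  proof safe
    fix y assume y: "y \<in> polar M"
    \<comment> \<open>The entries are inner products of points of M with y: polarity bounds them
      above by 1, relaxed to C to get a symmetric cube, and the vanishing centroid bounds them below
      by -C.\<close>
    have "(A *v y) $ i = A $ i \<bullet> y" for i
      by (simp add: matrix_vector_mult_def inner_vec_def)
    moreover have "- C \<le> A $ i \<bullet> y" "A $ i \<bullet> y \<le> C" for i
    proof -
      have Ai: "A $ i \<in> M" using A by (simp add: S_def)
      show "- C \<le> A $ i \<bullet> y"
        unfolding C_def by (rule inner_ge_if_mem_polar_centered[OF M Ai y])
      have "A $ i \<bullet> y \<le> 1" using y Ai by (auto simp: polar_def)
      then show "A $ i \<bullet> y \<le> C" using C by linarith
    qed
    ultimately show "A *v y \<in> ?Q C" by (auto simp: mem_box_cart)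
  qed
  have "\<bar>det A\<bar> * measure lborel (polar M) = measure lebesgue ((*v) A ` polar M)"
    by (simp only: meas(1)[OF cP] measure_matrix_image[OF meas(2)[OF cP]])
  also have "\<dots> \<le> measure lebesgue (?Q C)"
    by (intro measure_mono_fmeasurable fmeasurableD[OF image] sub cP) auto
  finally have 2: "\<bar>det A\<bar> * measure lborel (polar M) \<le> (2 * C) ^ CARD('n)" using Q C by simp
  have "measure lborel M * measure lborel (polar M)
      \<le> (\<bar>det A\<bar> * 2 ^ CARD('n)) * measure lborel (polar M)"
    using 1 by (intro mult_right_mono) auto
  also have "\<dots> \<le> 2 ^ CARD('n) * (2 * C) ^ CARD('n)" using 2 by (simp add: mult_ac)
  also have "\<dots> = (2 ^ (CARD('n) + 3)) ^ CARD('n)"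
    unfolding power_mult_distrib[symmetric] by (simp add: C_def power_add)
  finally show ?thesis .
qed

subsection \<open>Radial functions\<close>

text \<open>A common hull of star bodies and convex bodies: the radial function is then Borel (in fact
  upper semicontinuous) and bounded away from 0 and infinity, which is all that integration needs.\<close>

definition star_neighbourhood :: "(real ^ 'n) set \<Rightarrow> bool" where
  "star_neighbourhood L \<longleftrightarrow>
     compact L \<and> (\<forall>x\<in>L. closed_segment 0 x \<subseteq> L) \<and> (\<exists>e>0. cball 0 e \<subseteq> L)"

text \<open>The operator \<open>GREATEST\<close> is meaningful only if a maximum exists. Here the
  set of admissible factors is compact, and it contains 0.\<close>

lemma is_greatest_radial:
  fixes u :: "real ^ 'n"
  assumes "compact L" "0 \<in> L" "norm u = 1"
  shows "radial L u *\<^sub>R u \<in> L" and "\<And>l. l *\<^sub>R u \<in> L \<Longrightarrow> l \<le> radial L u"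
proof -
  let ?S = "{l. l *\<^sub>R u \<in> L}"
  obtain b where b: "\<And>x. x \<in> L \<Longrightarrow> norm x \<le> b"
    using compact_imp_bounded[OF assms(1)] by (auto simp: bounded_iff)
  have "?S = (\<lambda>l. l *\<^sub>R u) -` L" by auto
  then have "closed ?S"
    by (auto intro!: closed_vimage continuous_intros compact_imp_closed[OF assms(1)])
  moreover have "bounded ?S"
    unfolding bounded_iff using b assms(3) by (intro exI[of _ b]) force
  ultimately have "compact ?S" by (simp add: compact_eq_bounded_closed)
  moreover have "0 \<in> ?S" using assms(2) by simp
  ultimately obtain m where m: "m \<in> ?S" "\<And>l. l \<in> ?S \<Longrightarrow> l \<le> m"
    using compact_attains_sup[of ?S] by blast
  then have "radial L u = m" unfolding radial_def by (intro Greatest_equality) auto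
  then show "radial L u *\<^sub>R u \<in> L" and "\<And>l. l *\<^sub>R u \<in> L \<Longrightarrow> l \<le> radial L u"
    using m by auto
qed

lemma star_neighbourhood_zero: "star_neighbourhood L \<Longrightarrow> 0 \<in> L"
  unfolding star_neighbourhood_def by (metis centre_in_cball less_imp_le subsetD)

text \<open>The forward direction is maximality; the converse uses that L contains the segment from
  0 to its boundary point in direction u. This translates level sets of the radial function into
  conditions on L.\<close>

lemma scaleR_mem_iff_le_radial:
  assumes L: "star_neighbourhood L" and u: "norm u = 1" and l: "0 \<le> l"
  shows "l *\<^sub>R u \<in> L \<longleftrightarrow> l \<le> radial L u"
proof
  have cL: "compact L" "0 \<in> L" using L star_neighbourhood_zero star_neighbourhood_def by auto
  show "l \<le> radial L u" if "l *\<^sub>R u \<in> L"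
    using is_greatest_radial(2)[OF cL u that] .
  assume le: "l \<le> radial L u"
  show "l *\<^sub>R u \<in> L"
  proof (cases "l = 0")
    case False
    then have "l *\<^sub>R u = (1 - l / radial L u) *\<^sub>R 0 + (l / radial L u) *\<^sub>R (radial L u *\<^sub>R u)"
      "0 \<le> l / radial L u" "l / radial L u \<le> 1"
      using l le by auto
    then have "l *\<^sub>R u \<in> closed_segment 0 (radial L u *\<^sub>R u)"
      unfolding closed_segment_def by blast
    then show ?thesis
      using is_greatest_radial(1)[OF cL u] L unfolding star_neighbourhood_def by blast
  qed (use cL in simp)
qed

lemma radial_bounds:
  fixes L :: "(real ^ 'n) set"
  assumes L: "star_neighbourhood L"
  obtains a b where "0 < a" "\<And>u. norm u = 1 \<Longrightarrow> a \<le> radial L u \<and> radial L u \<le> b"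
proof -
  obtain a where a: "a > 0" "cball 0 a \<subseteq> L" using L by (auto simp: star_neighbourhood_def)
  obtain b where b: "\<And>x. x \<in> L \<Longrightarrow> norm x \<le> b"
    using L compact_imp_bounded[of L] by (auto simp: bounded_iff star_neighbourhood_def)
  have "a \<le> radial L u \<and> radial L u \<le> b" if u: "norm u = 1" for u
  proof
    have "a *\<^sub>R u \<in> L" using a u by (intro subsetD[OF a(2)]) auto
    then show ge: "a \<le> radial L u" using scaleR_mem_iff_le_radial[OF L u] a by simp
    have "radial L u *\<^sub>R u \<in> L" using scaleR_mem_iff_le_radial[OF L u] a ge by simp
    from b[OF this] show "radial L u \<le> b" using u by simp
  qed
  with a that show ?thesis by blast
qed

text \<open>The superlevel set at c > 0 is the part of the sphere that scaling by c sends into the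
  closed set L, hence closed in the sphere; for \<open>c \<le> 0\<close> it is the whole
  sphere.\<close>

lemma radial_measurable:
  fixes L :: "(real ^ 'n) set"
  assumes L: "star_neighbourhood L"
  shows "radial L \<in> borel_measurable (restrict_space borel (sphere 0 1))"
  unfolding borel_measurable_iff_ge
proof
  fix c
  show "{u \<in> space (restrict_space borel (sphere 0 1)). c \<le> radial L u}
      \<in> sets (restrict_space borel (sphere 0 1))"
  proof (cases "c \<le> 0")
    case True
    obtain a b where "0 < a" "\<And>u. norm u = 1 \<Longrightarrow> a \<le> radial L u \<and> radial L u \<le> b"
      using radial_bounds[OF L] by blast
    with True have "{u \<in> space (restrict_space borel (sphere 0 1)). c \<le> radial L u}
        = space (restrict_space borel (sphere 0 1))"
      by (force simp: space_restrict_space)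
    then show ?thesis by (metis sets.top)
  next
    case False
    then have "{u \<in> space (restrict_space borel (sphere 0 1)). c \<le> radial L u}
        = sphere 0 1 \<inter> (\<lambda>u. c *\<^sub>R u) -` L"
      using scaleR_mem_iff_le_radial[OF L, of _ c] by (auto simp: space_restrict_space)
    moreover have "closed ((\<lambda>u. c *\<^sub>R u) -` L)"
      using L by (intro closed_vimage continuous_intros compact_imp_closed)
        (simp add: star_neighbourhood_def)
    ultimately show ?thesis
      by (auto simp: sets_restrict_space intro!: imageI)
  qed
qed

text \<open>The case \<open>v = 0\<close> is included because the factor
  \<open>vrad (polar L)\<close> is only known to be nonnegative.\<close>

lemma radial_scaleR_image:
  fixes L :: "(real ^ 'n) set"
  assumes L: "star_neighbourhood L" and u: "norm u = 1" and v: "0 \<le> v"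
  shows "radial ((*\<^sub>R) v ` L) u = v * radial L u"
  unfolding radial_def[of "(*\<^sub>R) v ` L"]
proof (rule Greatest_equality)
  have cL: "compact L" "0 \<in> L" using L star_neighbourhood_zero star_neighbourhood_def by auto
  show "(v * radial L u) *\<^sub>R u \<in> (*\<^sub>R) v ` L"
    using is_greatest_radial(1)[OF cL u] by (auto simp flip: scaleR_scaleR)
  fix l assume "l *\<^sub>R u \<in> (*\<^sub>R) v ` L"
  then obtain x where x: "x \<in> L" "l *\<^sub>R u = v *\<^sub>R x" by auto
  show "l \<le> v * radial L u"
  proof (cases "v = 0")
    case True
    then show ?thesis using x u by auto
  next
    case False
    have "(l / v) *\<^sub>R u = inverse v *\<^sub>R (l *\<^sub>R u)" by (simp add: divide_inverse mult.commute)
    also have "\<dots> = x" using False by (simp add: x(2))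
    finally have "x = (l / v) *\<^sub>R u" by (rule sym)
    then have "l / v \<le> radial L u" using is_greatest_radial(2)[OF cL u] x by blast
    then show ?thesis using False v by (simp add: field_simps)
  qed
qed

text \<open>The continuous positive radial function attains a positive minimum on the sphere, and by
  star-shapedness the ball of that radius lies in K.\<close>

lemma star_neighbourhood_star_body:
  fixes K :: "(real ^ 'n) set"
  assumes "K \<in> star_bodies"
  shows "star_neighbourhood K"
proof -
  have K: "compact K" "K \<noteq> {}" "\<And>x. x \<in> K \<Longrightarrow> closed_segment 0 x \<subseteq> K"
    "continuous_on (sphere 0 1) (radial K)" "\<And>u. norm u = 1 \<Longrightarrow> 0 < radial K u"
    using assms by (auto simp: star_bodies_def)
  have "0 \<in> K" using K(2,3) by fastforce
  have "\<exists>w\<in>sphere 0 1. \<forall>u\<in>sphere 0 1. radial K w \<le> radial K u"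
    by (rule continuous_attains_inf) (use K in auto)
  then obtain w where w: "norm w = 1" "\<And>u. norm u = 1 \<Longrightarrow> radial K w \<le> radial K u" by auto
  have "cball 0 (radial K w) \<subseteq> K"
  proof
    fix x :: "real ^ 'n" assume x: "x \<in> cball 0 (radial K w)"
    show "x \<in> K"
    proof (cases "x = 0")
      case False
      define u where "u = x /\<^sub>R norm x"
      have u: "norm u = 1" "x = norm x *\<^sub>R u" using False by (auto simp: u_def)
      let ?c = "norm x / radial K u"
      have "norm x \<le> radial K u" using w(2)[OF u(1)] x by simp
      then have "0 \<le> ?c" "?c \<le> 1" using K(5)[OF u(1)] by auto
      moreover have "x = (1 - ?c) *\<^sub>R 0 + ?c *\<^sub>R (radial K u *\<^sub>R u)"
        using K(5)[OF u(1)] u(2) by simp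
      ultimately have "x \<in> closed_segment 0 (radial K u *\<^sub>R u)"
        unfolding closed_segment_def by blast
      then show ?thesis
        using is_greatest_radial(1)[OF K(1) \<open>0 \<in> K\<close> u(1)] K(3) by blast
    qed (use \<open>0 \<in> K\<close> in simp)
  qed
  then show ?thesis using K w unfolding star_neighbourhood_def by blast
qed

lemma star_neighbourhood_convex_body:
  assumes "K \<in> convex_bodies"
  shows "star_neighbourhood K"
proof -
  have K: "compact K" "convex K" "0 \<in> interior K" using assms by (auto simp: convex_bodies_def)
  then have "0 \<in> K" using interior_subset by blast
  then have "closed_segment 0 x \<subseteq> K" if "x \<in> K" for x
    using K(2) that by (intro closed_segment_subset)
  then show ?thesis using K by (auto simp: star_neighbourhood_def mem_interior_cball)
qed

section \<open>The unit ball as a competitor\<close>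

text \<open>The substitution of -x for x preserves Lebesgue measure and the ball, so the integral of
  x over the ball equals its own negative.\<close>

lemma cball_in_centered_bodies: "cball 0 1 \<in> (centered_bodies :: (real ^ 'n) set set)"
proof -
  let ?B = "cball 0 1 :: (real ^ 'n) set"
  have "(LINT x:?B|lborel. x) = (LINT x|lborel. indicator ?B x *\<^sub>R x)"
    by (simp add: set_lebesgue_integral_def)
  also have "\<dots> = (LINT x|density (distr lborel borel (\<lambda>x. 0 + (-1::real) *\<^sub>R x)) (\<lambda>_. ennreal 1). indicator ?B x *\<^sub>R x)"
    by (subst lborel_affine[of "-1" "0::real^'n"]) auto
  also have "\<dots> = - (LINT x|lborel. indicator ?B x *\<^sub>R x)"
    by (simp add: density_1 integral_distr indicator_def)
  finally have "(LINT x:?B|lborel. x) = 0"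
    by (simp add: set_lebesgue_integral_def vec_eq_iff)
  then show ?thesis
    by (simp add: centered_bodies_def convex_bodies_def centroid_def interior_cball)
qed

lemma polar_cball: "polar (cball 0 1) = (cball 0 1 :: (real ^ 'n) set)"
proof (intro equalityI subsetI)
  fix y :: "real ^ 'n" assume y: "y \<in> polar (cball 0 1)"
  show "y \<in> cball 0 1"
  proof (cases "y = 0")
    case False
    then have "y /\<^sub>R norm y \<in> cball 0 1" by simp
    then have "(y /\<^sub>R norm y) \<bullet> y \<le> 1" using y unfolding polar_def by blast
    then show ?thesis using False by (simp add: dot_square_norm power2_eq_square field_simps)
  qed simp
next
  fix y :: "real ^ 'n" assume y: "y \<in> cball 0 1"
  have "x \<bullet> y \<le> 1" if "norm x \<le> 1" for x
    using norm_cauchy_schwarz[of x y] mult_mono[of "norm x" 1 "norm y" 1] that y by auto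
  then show "y \<in> polar (cball 0 1)" by (auto simp: polar_def)
qed

lemma radial_cball: "norm (u :: real ^ 'n) = 1 \<Longrightarrow> radial (cball 0 1) u = 1"
  using is_greatest_radial[of "cball 0 1" u] by (force intro: antisym)

lemma cball_in_star_bodies: "cball 0 1 \<in> (star_bodies :: (real ^ 'n) set set)"
proof -
  have "continuous_on (sphere 0 1) (radial (cball 0 1) :: real ^ 'n \<Rightarrow> real)"
    by (rule continuous_on_eq[OF continuous_on_const[of _ 1]]) (simp add: radial_cball)
  moreover have "closed_segment 0 x \<subseteq> cball 0 1" if "x \<in> cball 0 1" for x :: "real ^ 'n"
    using that by (intro closed_segment_subset) auto
  ultimately show ?thesis by (simp add: star_bodies_def radial_cball)
qed

lemma star_neighbourhood_tilde:
  assumes "L \<in> K_tilde \<union> S_tilde"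
  shows "star_neighbourhood L"
  using assms star_neighbourhood_convex_body star_neighbourhood_star_body
  by (auto simp: K_tilde_def S_tilde_def centered_bodies_def santalo_bodies_def)

section \<open>The volume product of a general competitor\<close>

lemma subset_polar_polar: "L \<subseteq> polar (polar L)"
  by (auto simp: polar_def inner_commute)

text \<open>One of L, its polar and its bipolar is a centered body. Since every set lies in its
  bipolar, passing from L to its polar or bipolar does not decrease the volume product.\<close>

lemma volume_product_tilde_le:
  fixes L :: "(real ^ 'n) set"
  assumes L: "L \<in> K_tilde \<union> S_tilde"
  shows "measure lborel L * measure lborel (polar L) \<le> (2 ^ (CARD('n) + 3)) ^ CARD('n)"
proof -
  have cL: "compact L" using star_neighbourhood_tilde[OF L] by (simp add: star_neighbourhood_def)
  have mono: "measure lborel X \<le> measure lborel Y" if "closed X" "compact Y" "X \<subseteq> Y"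
    for X Y :: "(real ^ 'n) set"
    using that emeasure_bounded_finite[OF compact_imp_bounded, of Y]
    by (intro measure_mono_fmeasurable) (auto simp: fmeasurable_def borel_compact)
  have polar: "compact (polar M)" if "M \<in> centered_bodies" for M :: "(real ^ 'n) set"
    using that star_neighbourhood_convex_body[of M] compact_polar
    by (auto simp: centered_bodies_def star_neighbourhood_def)
  consider "L \<in> centered_bodies" | "polar L \<in> centered_bodies" | "polar (polar L) \<in> centered_bodies"
    using L by (auto simp: K_tilde_def S_tilde_def santalo_bodies_def)
  then show ?thesis
  proof cases
    case 1
    then show ?thesis by (rule volume_product_centered_le)
  next
    case 2
    have "measure lborel L \<le> measure lborel (polar (polar L))"
      by (intro mono compact_imp_closed cL polar 2 subset_polar_polar)
    then have "measure lborel L * measure lborel (polar L)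
        \<le> measure lborel (polar L) * measure lborel (polar (polar L))"
      unfolding mult.commute[of "measure lborel L"] by (rule mult_left_mono) simp
    then show ?thesis using volume_product_centered_le[OF 2] by linarith
  next
    case 3
    then have "compact (polar (polar L))" by (simp add: centered_bodies_def convex_bodies_def)
    then have "measure lborel L * measure lborel (polar L)
        \<le> measure lborel (polar (polar L)) * measure lborel (polar (polar (polar L)))"
      by (intro mult_mono mono compact_imp_closed[OF cL] polar[OF 3] subset_polar_polar closed_polar
          measure_nonneg)
    then show ?thesis using volume_product_centered_le[OF 3] by linarith
  qed
qed

subsection \<open>Integrals over the sphere\<close>

lemma space_spherical_measure [simp]: "space spherical_measure = sphere (0 :: real ^ 'n) 1"
  by (simp add: spherical_measure_def space_restrict_space space_scale_measure)

lemma sets_spherical_measure [measurable_cong, simp]: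
  "sets (spherical_measure :: (real ^ 'n) measure) = sets (restrict_space borel (sphere 0 1))"
  by (simp add: spherical_measure_def)

text \<open>The cone that occurs in \<open>emeasure_spherical_measure\<close>. The apex is left out,
  so that every point has a direction.\<close>

definition radial_cone :: "(real ^ 'n) set \<Rightarrow> (real ^ 'n) set" where
  "radial_cone A = {t *\<^sub>R u |t u. 0 < t \<and> t \<le> 1 \<and> u \<in> A}"

text \<open>Exhibits the cone as a preimage under the projection to the sphere, from which its Borel
  measurability can be read off.\<close>

lemma radial_cone_eq:
  assumes "A \<subseteq> sphere 0 1"
  shows "radial_cone A = {x \<in> cball 0 1 - {0}. x /\<^sub>R norm x \<in> A}"
proof (intro equalityI subsetI)
  fix x assume "x \<in> {x \<in> cball 0 1 - {0}. x /\<^sub>R norm x \<in> A}"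
  then have "x = norm x *\<^sub>R (x /\<^sub>R norm x)" "0 < norm x" "norm x \<le> 1" "x /\<^sub>R norm x \<in> A"
    by auto
  then show "x \<in> radial_cone A" unfolding radial_cone_def by blast
next
  fix x assume "x \<in> radial_cone A"
  then obtain t u where tu: "x = t *\<^sub>R u" "0 < t" "t \<le> 1" "u \<in> A"
    by (auto simp: radial_cone_def)
  then have "norm u = 1" using assms by auto
  with tu show "x \<in> {x \<in> cball 0 1 - {0}. x /\<^sub>R norm x \<in> A}" by auto
qed

lemma fmeasurable_radial_cone:
  fixes A :: "(real ^ 'n) set"
  assumes "A \<in> sets borel" "A \<subseteq> sphere 0 1"
  shows "radial_cone A \<in> fmeasurable lborel"
proof (rule fmeasurableI2)
  show "(cball 0 1 :: (real ^ 'n) set) \<in> fmeasurable lborel"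
    using emeasure_bounded_finite[of "cball 0 1 :: (real ^ 'n) set"] by (simp add: fmeasurable_def)
  show "radial_cone A \<in> sets lborel"
    unfolding radial_cone_eq[OF assms(2)] using assms(1) by measurable
  show "radial_cone A \<subseteq> cball 0 1" unfolding radial_cone_eq[OF assms(2)] by auto
qed

lemma measure_spherical_measure:
  fixes A :: "(real ^ 'n) set"
  assumes "A \<in> sets borel" "A \<subseteq> sphere 0 1"
  shows "measure spherical_measure A = real CARD('n) * measure lborel (radial_cone A)"
  unfolding measure_def emeasure_spherical_measure[OF assms] radial_cone_def[symmetric]
  by (simp add: enn2real_mult)

lemma finite_measure_spherical_measure: "finite_measure (spherical_measure :: (real ^ 'n) measure)"
proof
  have "emeasure lborel (radial_cone (sphere 0 1 :: (real ^ 'n) set)) \<noteq> \<infinity>"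
    using fmeasurable_radial_cone[of "sphere 0 1"] by (auto simp: fmeasurable_def less_top[symmetric])
  then show "emeasure spherical_measure (space (spherical_measure :: (real ^ 'n) measure)) \<noteq> \<infinity>"
    using emeasure_spherical_measure[of "sphere 0 1 :: (real ^ 'n) set", folded radial_cone_def]
    by (simp add: ennreal_mult_eq_top_iff)
qed

text \<open>The cones over the dyadic level sets, dilated by \<open>2 ^ k\<close>, are disjoint subsets of v L. This
  replaces integration in polar coordinates, up to the factor \<open>2 ^ n\<close>.\<close>

lemma sum_measure_dyadic_cones_le:
  fixes L :: "(real ^ 'n) set"
  assumes L: "star_neighbourhood L" and v: "0 \<le> v"
  defines "A \<equiv> \<lambda>k::nat. {u \<in> sphere 0 1. 2 ^ k < v * radial L u \<and> v * radial L u \<le> 2 ^ (k + 1)}"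
  shows "(\<Sum>k<N. (2 ^ k) ^ CARD('n) * measure lborel (radial_cone (A k))) \<le> v ^ CARD('n) * measure lborel L"
    and "\<And>k. A k \<in> sets borel"
proof -
  note radial_measurable[OF L, measurable]
  have AS: "A k \<subseteq> sphere 0 1" for k by (auto simp: A_def)
  show Am: "A k \<in> sets borel" for k
  proof -
    have "{u \<in> space (restrict_space borel (sphere 0 1)).
        2 ^ k < v * radial L u \<and> v * radial L u \<le> 2 ^ (k + 1)} \<in> sets (restrict_space borel (sphere 0 1))"
      by measurable
    then show ?thesis by (auto simp: A_def space_restrict_space sets_restrict_space_iff)
  qed
  define D where "D k = (*\<^sub>R) (2 ^ k) ` radial_cone (A k)" for k :: nat
  have scale: "measure lebesgue ((*\<^sub>R) c ` S) = \<bar>c\<bar> ^ CARD('n) * measure lebesgue S"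
    for c :: real and S :: "(real ^ 'n) set"
    using measure_lebesgue_affine[of c 0 S] by simp
  have cone: "radial_cone (A k) \<in> lmeasurable" for k
    using fmeasurable_radial_cone[OF Am AS] by (auto simp: fmeasurable_def)
  have D: "D k \<in> lmeasurable" for k
    unfolding D_def using linear_image_lmeasurable_and_measure[OF linear_scaleR] cone by blast
  have cL: "compact L" using L by (simp add: star_neighbourhood_def)
  have "(\<Sum>k<N. (2 ^ k) ^ CARD('n) * measure lborel (radial_cone (A k))) = (\<Sum>k<N. measure lebesgue (D k))"
    using fmeasurable_radial_cone[OF Am AS]
    by (intro sum.cong) (auto simp: D_def scale fmeasurable_def)
  also have "\<dots> = measure lebesgue (\<Union>k<N. D k)"
  proof (rule measure_UNION'[symmetric])
    \<comment> \<open>The direction of x recovers u, and the half-open dyadic intervals are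
      disjoint, so x determines its level.\<close>
    have "k = k'" if "x \<in> D k" "x \<in> D k'" for x k k'
    proof -
      have *: "2 ^ k < v * radial L (x /\<^sub>R norm x) \<and> v * radial L (x /\<^sub>R norm x) \<le> 2 ^ (k + 1)"
        if "x \<in> D k" for k
      proof -
        from that obtain t u where "x = (2 ^ k * t) *\<^sub>R u" "0 < t" "u \<in> A k"
          by (auto simp: D_def radial_cone_def)
        moreover from this have "x /\<^sub>R norm x = u" by (auto simp: A_def field_simps)
        ultimately show ?thesis by (auto simp: A_def)
      qed
      from *[OF that(1)] *[OF that(2)] have "(2::real) ^ k < 2 ^ (k' + 1)" "(2::real) ^ k' < 2 ^ (k + 1)"
        by linarith+
      then have "k < k' + 1" "k' < k + 1" by (auto simp only: power_strict_increasing_iff one_less_numeral_iff semiring_norm)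
      then show ?thesis by simp
    qed
    then show "pairwise (\<lambda>k k'. disjnt (D k) (D k')) {..<N}"
      by (force simp: pairwise_def disjnt_def)
  qed (use D in auto)
  also have "\<dots> \<le> measure lebesgue ((*\<^sub>R) v ` L)"
  proof (rule measure_mono_fmeasurable)
    show "(*\<^sub>R) v ` L \<in> lmeasurable"
      by (intro lmeasurable_compact compact_scaling cL)
    show "(\<Union>k<N. D k) \<in> sets lebesgue" using D by (auto intro!: sets.finite_UN)
    show "(\<Union>k<N. D k) \<subseteq> (*\<^sub>R) v ` L"
    proof safe
      fix k x assume "x \<in> D k"
      then obtain t u where x: "x = (2 ^ k * t) *\<^sub>R u" "0 < t" "t \<le> 1" "u \<in> A k"
        by (auto simp: D_def radial_cone_def)
      have u: "norm u = 1" "2 ^ k < v * radial L u" using x by (auto simp: A_def)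
      have "v > 0" using u v by (cases "v = 0") auto
      \<comment> \<open>A point of the dilated cone has length at most \<open>2 ^ k\<close>, which
        is below the radial function of v L in its direction.\<close>
      have "2 ^ k * t \<le> 2 ^ k * (1::real)" using x by (intro mult_left_mono) auto
      then have "2 ^ k * t \<le> v * radial L u" using u by linarith
      then have "(2 ^ k * t / v) *\<^sub>R u \<in> L"
        using \<open>v > 0\<close> x scaleR_mem_iff_le_radial[OF L u(1), of "2 ^ k * t / v"]
        by (simp add: field_simps)
      then show "x \<in> (*\<^sub>R) v ` L" using \<open>v > 0\<close> x by (intro image_eqI) auto
    qed
  qed
  also have "\<dots> = v ^ CARD('n) * measure lborel L"
    using v cL by (simp add: scale borel_compact)
  finally show "(\<Sum>k<N. (2 ^ k) ^ CARD('n) * measure lborel (radial_cone (A k))) \<le> v ^ CARD('n) * measure lborel L" .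
qed

text \<open>Where the scaled radial function is at most 1, so is its power, which accounts for the
  mass of the sphere. Elsewhere the power is at most the n-th power, bounded on each dyadic level
  set by its value at the upper endpoint, which costs the factor \<open>2 ^ n\<close>. The factor n
  converts cone volume into spherical measure.\<close>

lemma powr_radial_integral_le:
  fixes L :: "(real ^ 'n) set"
  assumes L: "star_neighbourhood L" and v: "0 \<le> v" and p: "0 < p" "p \<le> real CARD('n)"
  shows "(LINT u|spherical_measure. (v * radial L u) powr p)
      \<le> measure spherical_measure (sphere (0 :: real ^ 'n) 1)
        + real CARD('n) * 2 ^ CARD('n) * (v ^ CARD('n) * measure lborel L)"
proof -
  let ?n = "CARD('n)"
  let ?\<sigma> = "spherical_measure :: (real ^ 'n) measure"
  interpret finite_measure ?\<sigma> by (rule finite_measure_spherical_measure)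
  define A where "A k = {u \<in> sphere 0 1. 2 ^ k < v * radial L u \<and> v * radial L u \<le> 2 ^ (k + 1)}" for k :: nat
  note dyadic = sum_measure_dyadic_cones_le[OF L v, folded A_def]
  have A: "A k \<in> sets borel" "A k \<subseteq> sphere 0 1" for k using dyadic(2) by (auto simp: A_def)
  then have A': "A k \<in> sets ?\<sigma>" for k by (auto simp: sets_restrict_space)
  obtain a b where ab: "0 < a" "\<And>u. norm u = 1 \<Longrightarrow> a \<le> radial L u \<and> radial L u \<le> b"
    using radial_bounds[OF L] by blast
  \<comment> \<open>The radial function is bounded, so finitely many dyadic levels cover all its
    values above 1.\<close>
  obtain N where N: "v * b < 2 ^ N" using real_arch_pow[of 2 "v * b"] by auto
  let ?g = "\<lambda>u. 1 + (\<Sum>k<N. (2 ^ (k + 1)) ^ ?n * indicator (A k) u :: real)"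
  have gi: "integrable ?\<sigma> (\<lambda>u. (2 ^ (k + 1)) ^ ?n * indicator (A k) u :: real)" for k
    using A' by (intro integrable_mult_right) (auto simp: less_top[symmetric])
  have "(LINT u|?\<sigma>. (v * radial L u) powr p) \<le> (LINT u|?\<sigma>. ?g u)"
  proof (rule integral_mono')
    show "integrable ?\<sigma> ?g" using gi by (intro Bochner_Integration.integrable_add integrable_const Bochner_Integration.integrable_sum)
    show "0 \<le> ?g u" for u by (auto intro!: add_nonneg_nonneg sum_nonneg)
    fix u assume "u \<in> space ?\<sigma>"
    then have u: "norm u = 1" by simp
    define f where "f = v * radial L u"
    have f0: "0 \<le> f" using v ab(2)[OF u] ab(1) by (auto simp: f_def)
    have fN: "f \<le> 2 ^ N"
      using N mult_left_mono[OF conjunct2[OF ab(2)[OF u]] v] by (simp add: f_def)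
    show "(v * radial L u) powr p \<le> ?g u"
    proof (cases "f \<le> 1")
      case True
      then have "f powr p \<le> 1" using f0 p powr_mono2[of p f 1] by simp
      moreover have "0 \<le> (\<Sum>k<N. (2 ^ (k + 1)) ^ ?n * indicator (A k) u :: real)"
        by (auto intro!: sum_nonneg)
      ultimately show ?thesis by (simp add: f_def)
    next
      case False
      \<comment> \<open>The least m with \<open>f \<le> 2 ^ m\<close> is positive because f > 1; its
        predecessor k is the dyadic level of u, and k < N.\<close>
      define m where "m = (LEAST m. f \<le> 2 ^ m)"
      have m: "f \<le> 2 ^ m" "m \<le> N" unfolding m_def using fN by (auto intro: LeastI Least_le)
      then obtain k where k: "m = Suc k" using False by (cases m) auto
      have "\<not> f \<le> 2 ^ k" using not_less_Least[of k "\<lambda>m. f \<le> 2 ^ m"] k by (simp add: m_def)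
      then have uA: "u \<in> A k" using m k u by (auto simp: A_def f_def)
      have "f powr p \<le> f powr real ?n" using False p by (intro powr_mono) auto
      also have "\<dots> = f ^ ?n" using False by (simp add: powr_realpow)
      also have "\<dots> \<le> (2 ^ (k + 1)) ^ ?n" using m k f0 by (intro power_mono) auto
      also have "\<dots> = (2 ^ (k + 1)) ^ ?n * indicator (A k) u" using uA by simp
      also have "\<dots> \<le> (\<Sum>k<N. (2 ^ (k + 1)) ^ ?n * indicator (A k) u)"
        using m k by (intro member_le_sum) auto
      finally show ?thesis by (simp add: f_def)
    qed
  qed
  also have "\<dots> = measure ?\<sigma> (sphere 0 1) + (\<Sum>k<N. (2 ^ (k + 1)) ^ ?n * measure ?\<sigma> (A k))"
  proof -
    have "(LINT u|?\<sigma>. ?g u) = (LINT u|?\<sigma>. 1) + (\<Sum>k<N. LINT u|?\<sigma>. (2 ^ (k + 1)) ^ ?n * indicator (A k) u)"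
      by (subst Bochner_Integration.integral_add, intro integrable_const,
        intro Bochner_Integration.integrable_sum gi,
        subst Bochner_Integration.integral_sum, intro gi, rule refl)
    moreover have "(LINT u|?\<sigma>. (2 ^ (k + 1)) ^ ?n * indicator (A k) u) = (2 ^ (k + 1)) ^ ?n * measure ?\<sigma> (A k)" for k
      using A(2)[of k] by (simp add: Int_absorb2)
    ultimately show ?thesis by simp
  qed
  also have "(\<Sum>k<N. (2 ^ (k + 1)) ^ ?n * measure ?\<sigma> (A k))
      = real ?n * 2 ^ ?n * (\<Sum>k<N. (2 ^ k) ^ ?n * measure lborel (radial_cone (A k)))"
    unfolding sum_distrib_left
    by (intro sum.cong) (auto simp: measure_spherical_measure[OF A] power_mult_distrib)
  also have "\<dots> \<le> real ?n * 2 ^ ?n * (v ^ ?n * measure lborel L)"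
    by (intro mult_left_mono dyadic) auto
  finally show ?thesis by simp
qed

subsection \<open>Normalized dual mixed volumes\<close>

lemma vrad_nonneg: "0 \<le> vrad L"
  by (simp add: vrad_def)

lemma vrad_power:
  fixes L :: "(real ^ 'n) set"
  shows "vrad L ^ CARD('n) = measure lborel L / measure lborel (cball (0 :: real ^ 'n) 1)"
proof -
  let ?x = "measure lborel L / measure lborel (cball (0 :: real ^ 'n) 1)"
  have "vrad L ^ CARD('n) = (?x powr (1 / real CARD('n))) powr real CARD('n)"
    unfolding vrad_def by (subst powr_realpow') auto
  also have "\<dots> = ?x" by (simp add: powr_powr)
  finally show ?thesis .
qed

definition normalized_mixed_volume :: "real \<Rightarrow> (real ^ 'n) set \<Rightarrow> (real ^ 'n) set \<Rightarrow> real" where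
  "normalized_mixed_volume p K L =
     real CARD('n) * dual_mixed_volume p K ((*\<^sub>R) (vrad (polar L)) ` L)"

lemma normalized_mixed_volume_eq:
  fixes K L :: "(real ^ 'n) set"
  assumes L: "star_neighbourhood L"
  shows "normalized_mixed_volume p K L = (LINT u|spherical_measure.
    (vrad (polar L) * radial L u / radial K u) powr p * radial K u ^ CARD('n))"
proof -
  have "normalized_mixed_volume p K L = (LINT u|spherical_measure.
      (radial ((*\<^sub>R) (vrad (polar L)) ` L) u / radial K u) powr p * radial K u ^ CARD('n))"
    by (simp add: normalized_mixed_volume_def dual_mixed_volume_def)
  also have "\<dots> = (LINT u|spherical_measure.
      (vrad (polar L) * radial L u / radial K u) powr p * radial K u ^ CARD('n))"
    by (intro Bochner_Integration.integral_cong refl) (simp add: radial_scaleR_image[OF L _ vrad_nonneg])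
  finally show ?thesis .
qed

text \<open>For v > 0 the ratio of radial functions stays between two positive constants; the sum of
  the powers of both bounds its power for either sign of p. For \<open>v = 0\<close> the integrand
  is 0, since \<open>0 powr p = 0\<close> for every p.\<close>

lemma integrable_mixed_volume:
  fixes K L :: "(real ^ 'n) set"
  assumes K: "star_neighbourhood K" and L: "star_neighbourhood L" and v: "0 \<le> v"
  shows "integrable spherical_measure (\<lambda>u. (v * radial L u / radial K u) powr p * radial K u ^ CARD('n))"
proof (cases "v = 0")
  case False
  let ?\<sigma> = "spherical_measure :: (real ^ 'n) measure"
  interpret finite_measure ?\<sigma> by (rule finite_measure_spherical_measure)
  note radial_measurable[OF K, measurable] radial_measurable[OF L, measurable]
  obtain a b where ab: "0 < a" "\<And>u. norm u = 1 \<Longrightarrow> a \<le> radial K u \<and> radial K u \<le> b"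
    using radial_bounds[OF K] by blast
  obtain c d where cd: "0 < c" "\<And>u. norm u = 1 \<Longrightarrow> c \<le> radial L u \<and> radial L u \<le> d"
    using radial_bounds[OF L] by blast
  have "norm ((v * radial L u / radial K u) powr p * radial K u ^ CARD('n))
      \<le> ((v * c / b) powr p + (v * d / a) powr p) * b ^ CARD('n)" if u: "norm u = 1" for u
  proof -
    let ?h = "v * radial L u / radial K u"
    have pos: "0 < radial K u" "0 < radial L u" "0 < b" using ab cd u by (smt (verit))+
    have h: "v * c / b \<le> ?h" "?h \<le> v * d / a"
      using ab(1) ab(2)[OF u] cd(1) cd(2)[OF u] v pos by (auto intro!: frac_le mult_left_mono mult_nonneg_nonneg)
    have "?h powr p \<le> (v * c / b) powr p + (v * d / a) powr p"
    proof (cases "0 \<le> p")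
      case True
      then have "?h powr p \<le> (v * d / a) powr p" using h(2) v pos by (intro powr_mono2) auto
      then show ?thesis by (simp add: add_increasing)
    next
      case p: False
      have "0 < v * c / b" using v False cd(1) pos by auto
      then have "?h powr p \<le> (v * c / b) powr p" using h(1) p by (intro powr_mono2') auto
      then show ?thesis by (simp add: add_increasing2)
    qed
    moreover have "radial K u ^ CARD('n) \<le> b ^ CARD('n)" using ab(2)[OF u] pos by (intro power_mono) auto
    ultimately show ?thesis using pos by (auto simp: abs_mult intro!: mult_mono)
  qed
  then show ?thesis
    by (intro integrable_const_bound[of _ "((v * c / b) powr p + (v * d / a) powr p) * b ^ CARD('n)"]) auto
qed simp

lemma normalized_mixed_volume_nonneg:
  assumes K: "star_neighbourhood K" and L: "star_neighbourhood L"
  shows "0 \<le> normalized_mixed_volume p K L"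
proof -
  obtain a b where "0 < a" "\<And>u. norm u = 1 \<Longrightarrow> a \<le> radial K u \<and> radial K u \<le> b"
    using radial_bounds[OF K] by blast
  then have "0 \<le> radial K u" if "norm u = 1" for u using that by (smt (verit))
  then show ?thesis
    unfolding normalized_mixed_volume_eq[OF L] by (intro Bochner_Integration.integral_nonneg) auto
qed

text \<open>The exponent r is the convex combination of q and s with the weights on the right, so
  the integrand for r is a weighted geometric mean of those for q and s, and Hoelder's inequality
  applies.\<close>

lemma normalized_mixed_volume_log_convex:
  fixes K L :: "(real ^ 'n) set"
  assumes K: "star_neighbourhood K" and L: "star_neighbourhood L" and "s < r" "r < q"
  shows "normalized_mixed_volume r K L
    \<le> normalized_mixed_volume q K L powr ((r - s) / (q - s)) * normalized_mixed_volume s K L powr ((q - r) / (q - s))"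
proof -
  let ?a = "(r - s) / (q - s)" and ?b = "(q - r) / (q - s)"
  have ab: "0 < ?a" "0 < ?b" "?a + ?b = 1"
    using assms(3,4) by (auto simp: add_divide_distrib[symmetric])
  have "q * ?a + s * ?b = (q * (r - s) + s * (q - r)) / (q - s)" by (simp add: add_divide_distrib)
  also have "\<dots> = (r * (q - s)) / (q - s)" by (simp add: algebra_simps)
  also have "\<dots> = r" using assms(3,4) by simp
  finally have r: "q * ?a + s * ?b = r" .
  define h where "h u = vrad (polar L) * radial L u / radial K u" for u
  define w where "w u = radial K u ^ CARD('n)" for u
  have eq: "normalized_mixed_volume p K L = (LINT u|spherical_measure. h u powr p * w u)" for p
    unfolding h_def w_def by (rule normalized_mixed_volume_eq[OF L])
  have int: "integrable spherical_measure (\<lambda>u. h u powr p * w u)" for p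
    unfolding h_def w_def by (rule integrable_mixed_volume[OF K L vrad_nonneg])
  obtain a' b' where "0 < a'" "\<And>u. norm u = 1 \<Longrightarrow> a' \<le> radial K u \<and> radial K u \<le> b'"
    using radial_bounds[OF K] by blast
  then have w: "0 < w u" if "norm u = 1" for u
    using that unfolding w_def by (intro zero_less_power) (smt (verit))
  \<comment> \<open>This covers \<open>h u = 0\<close> too, that is, a vanishing
    \<open>vrad (polar L)\<close>: all powers of 0 are 0.\<close>
  have "h u powr r * w u = (h u powr q * w u) powr ?a * (h u powr s * w u) powr ?b" if u: "norm u = 1" for u
  proof -
    have "(h u powr q * w u) powr ?a * (h u powr s * w u) powr ?b
        = (h u powr (q * ?a) * h u powr (s * ?b)) * (w u powr ?a * w u powr ?b)"
      using w[OF u] by (simp only: powr_mult powr_powr powr_ge_zero less_imp_le mult_ac)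
    also have "\<dots> = h u powr r * w u"
      using w[OF u] by (simp only: powr_add[symmetric] r ab(3) powr_one less_imp_le)
    finally show ?thesis ..
  qed
  then have "normalized_mixed_volume r K L
      = (LINT u|spherical_measure. (h u powr q * w u) powr ?a * (h u powr s * w u) powr ?b)"
    unfolding eq by (intro Bochner_Integration.integral_cong) auto
  also have "\<dots> \<le> (LINT u|spherical_measure. h u powr q * w u) powr ?a
      * (LINT u|spherical_measure. h u powr s * w u) powr ?b"
    using w by (intro integral_powr_mult_le int ab) (auto intro!: mult_nonneg_nonneg intro: less_imp_le)
  finally show ?thesis unfolding eq .
qed

text \<open>The bounds a and b on the radial function of K reduce the claim to integrals of
  \<open>(v * radial L u) powr p\<close>. These are controlled by \<open>v ^ n\<close> times the
  volume of L, which is the volume product of L divided by the volume of the ball and thus bounded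
  independently of L.\<close>

lemma bdd_above_normalized_mixed_volume:
  fixes K :: "(real ^ 'n) set"
  assumes K: "star_neighbourhood K" and p: "0 < p" "p < real CARD('n)"
    and \<C>: "\<C> \<subseteq> K_tilde \<union> S_tilde"
  shows "bdd_above (normalized_mixed_volume p K ` \<C>)"
proof -
  let ?n = "CARD('n)"
  let ?\<sigma> = "spherical_measure :: (real ^ 'n) measure"
  let ?B = "measure lborel (cball (0 :: real ^ 'n) 1)"
  let ?C = "((2::real) ^ (?n + 3)) ^ ?n / ?B"
  let ?D = "measure ?\<sigma> (sphere 0 1) + real ?n * 2 ^ ?n * ?C"
  obtain a b where ab: "0 < a" "\<And>u. norm u = 1 \<Longrightarrow> a \<le> radial K u \<and> radial K u \<le> b"
    using radial_bounds[OF K] by blast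
  have "normalized_mixed_volume p K L \<le> b ^ ?n / a powr p * ?D" if "L \<in> \<C>" for L
  proof -
    have LC: "L \<in> K_tilde \<union> S_tilde" using that \<C> by blast
    have L: "star_neighbourhood L" using star_neighbourhood_tilde[OF LC] .
    define v where "v = vrad (polar L)"
    have v: "0 \<le> v" by (simp add: v_def vrad_nonneg)
    obtain c d where cd: "0 < c" "\<And>u. norm u = 1 \<Longrightarrow> c \<le> radial L u \<and> radial L u \<le> d"
      using radial_bounds[OF L] by blast
    have one: "star_neighbourhood (cball 0 1 :: (real ^ 'n) set)"
      using star_neighbourhood_star_body[OF cball_in_star_bodies] .
    have "normalized_mixed_volume p K L = (LINT u|?\<sigma>. (v * radial L u / radial K u) powr p * radial K u ^ ?n)"
      unfolding v_def by (rule normalized_mixed_volume_eq[OF L])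
    also have "\<dots> \<le> (LINT u|?\<sigma>. b ^ ?n / a powr p * (v * radial L u) powr p)"
    proof (rule integral_mono)
      \<comment> \<open>Taking the unit ball, whose radial function is 1, in place of K gives the
        integrability of the plain power.\<close>
      have "integrable ?\<sigma> (\<lambda>u. (v * radial L u / radial (cball 0 1) u) powr p * radial (cball 0 1) u ^ ?n)"
        by (rule integrable_mixed_volume[OF one L v])
      then have "integrable ?\<sigma> (\<lambda>u. (v * radial L u) powr p)"
        by (rule Bochner_Integration.integrable_cong[THEN iffD1, rotated 2]) (auto simp: radial_cball)
      then show "integrable ?\<sigma> (\<lambda>u. b ^ ?n / a powr p * (v * radial L u) powr p)" by simp
      fix u assume "u \<in> space ?\<sigma>"
      then have u: "norm u = 1" by simp
      have pos: "0 < radial K u" "0 < radial L u" "0 < b" using ab cd u by (smt (verit))+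
      have "(v * radial L u / radial K u) powr p \<le> (v * radial L u / a) powr p"
        using ab(1) ab(2)[OF u] pos v p by (intro powr_mono2 frac_le) auto
      also have "\<dots> = (v * radial L u) powr p / a powr p"
        using pos v ab(1) by (simp add: powr_divide)
      finally have "(v * radial L u / radial K u) powr p * radial K u ^ ?n \<le> (v * radial L u) powr p / a powr p * b ^ ?n"
        using ab(2)[OF u] pos by (intro mult_mono power_mono) auto
      then show "(v * radial L u / radial K u) powr p * radial K u ^ ?n \<le> b ^ ?n / a powr p * (v * radial L u) powr p"
        by (simp add: mult_ac)
    qed (rule integrable_mixed_volume[OF K L v])
    also have "\<dots> = b ^ ?n / a powr p * (LINT u|?\<sigma>. (v * radial L u) powr p)" by simp
    also have "\<dots> \<le> b ^ ?n / a powr p * ?D"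
    proof (rule mult_left_mono)
      have B: "0 < ?B" by (simp add: content_cball_pos)
      have "v ^ ?n * measure lborel L = measure lborel L * measure lborel (polar L) / ?B"
        by (simp add: v_def vrad_power)
      also have "\<dots> \<le> ?C" using volume_product_tilde_le[OF LC] B by (intro divide_right_mono) auto
      finally have "real ?n * 2 ^ ?n * (v ^ ?n * measure lborel L) \<le> real ?n * 2 ^ ?n * ?C"
        by (intro mult_left_mono) auto
      then show "(LINT u|?\<sigma>. (v * radial L u) powr p) \<le> ?D"
        using powr_radial_integral_le[OF L v p(1)] p(2) by linarith
      \<comment> \<open>Since b is only a bound for values on the sphere, its sign is read off at
        some unit vector.\<close>
      obtain u :: "real ^ 'n" where "norm u = 1" using norm_axis_1 by blast
      with ab have "0 \<le> b" by (smt (verit))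
      then show "0 \<le> b ^ ?n / a powr p" by simp
    qed
    finally show ?thesis .
  qed
  then show ?thesis by (rule bdd_aboveI2)
qed

section \<open>Infima and suprema over the competitors\<close>

text \<open>If c and y are positive, the hypothesis can be solved for \<open>f x\<close>: the number
  \<open>(y / c) powr (1 / b)\<close> is a lower bound of f, hence at most the infimum, and taking
  the power b restores the claim.\<close>

lemma le_powr_mult_cINF:
  fixes f :: "'a \<Rightarrow> real"
  assumes "X \<noteq> {}" "\<And>x. x \<in> X \<Longrightarrow> 0 \<le> f x" and le: "\<And>x. x \<in> X \<Longrightarrow> y \<le> c * f x powr b"
    and "0 \<le> c" "0 < b"
  shows "y \<le> c * (INF x\<in>X. f x) powr b"
proof (cases "c = 0")
  case True
  then show ?thesis using le assms(1) by fastforce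
next
  case False
  then have c: "0 < c" using assms(4) by simp
  have bdd: "0 \<le> (INF x\<in>X. f x)" using assms(1,2) by (intro cINF_greatest)
  show ?thesis
  proof (cases "y \<le> 0")
    case True
    then show ?thesis using c by (meson mult_nonneg_nonneg less_imp_le order.trans powr_ge_zero)
  next
    case False
    then have y: "0 < y / c" using c by simp
    have "(y / c) powr (1 / b) \<le> f x" if "x \<in> X" for x
    proof -
      have "y / c \<le> f x powr b" using le[OF that] c by (simp add: field_simps)
      then have "(y / c) powr (1 / b) \<le> (f x powr b) powr (1 / b)"
        using y assms(5) by (intro powr_mono2) auto
      then show ?thesis using assms(2)[OF that] assms(5) by (simp add: powr_powr)
    qed
    then have "(y / c) powr (1 / b) \<le> (INF x\<in>X. f x)" using assms(1) by (intro cINF_greatest)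
    then have "((y / c) powr (1 / b)) powr b \<le> (INF x\<in>X. f x) powr b"
      using assms(5) by (intro powr_mono2) auto
    then show ?thesis using y c assms(5) by (simp add: powr_powr field_simps)
  qed
qed

text \<open>Exponents in (0, n) belong to suprema, all others to infima. In each case at most one
  factor on the right is an infimum; the other is first replaced by its supremum, which is finite,
  and only then is the remaining extremum taken over L.\<close>

lemma orlicz_extremum_log_convex:
  fixes q r s :: real and K :: "(real ^ 'n) set"
  assumes \<C>: "\<C> \<subseteq> K_tilde \<union> S_tilde" "\<C> \<noteq> {}"
    and cases: "(s < r \<and> r < 0 \<and> 0 < q \<and> q < real CARD('n)) \<or>
         (0 < s \<and> s < r \<and> r < q \<and> q < real CARD('n)) \<or>
         (0 < s \<and> s < real CARD('n) \<and> real CARD('n) < r \<and> r < q)"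
    and "K \<in> star_bodies"
  shows "orlicz_extremum \<C> r K
    \<le> orlicz_extremum \<C> q K powr ((r - s) / (q - s)) * orlicz_extremum \<C> s K powr ((q - r) / (q - s))"
proof -
  let ?V = "\<lambda>p. normalized_mixed_volume p K"
  let ?a = "(r - s) / (q - s)" and ?b = "(q - r) / (q - s)"
  have K: "star_neighbourhood K" using star_neighbourhood_star_body assms(4) by blast
  have L: "star_neighbourhood L" if "L \<in> \<C>" for L using star_neighbourhood_tilde that \<C> by blast
  have order: "s < r" "r < q" using cases by auto
  then have ab: "0 < ?a" "0 < ?b" by auto
  have INF: "orlicz_extremum \<C> p K = (INF L\<in>\<C>. ?V p L)" if "p < 0 \<or> real CARD('n) < p" for p
    using that by (simp add: orlicz_extremum_def normalized_mixed_volume_def)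
  have SUP: "orlicz_extremum \<C> p K = (SUP L\<in>\<C>. ?V p L)" if "0 < p" "p < real CARD('n)" for p
    using that by (simp add: orlicz_extremum_def normalized_mixed_volume_def)
  have nonneg: "0 \<le> ?V p L" if "L \<in> \<C>" for p L
    using normalized_mixed_volume_nonneg[OF K L[OF that]] .
  have below: "(INF L\<in>\<C>. ?V p L) \<le> ?V p L" if "L \<in> \<C>" for p L
    using nonneg that by (intro cINF_lower bdd_belowI2[of _ 0])
  have above: "?V p L \<le> (SUP L\<in>\<C>. ?V p L)" if "L \<in> \<C>" "0 < p" "p < real CARD('n)" for p L
    using bdd_above_normalized_mixed_volume[OF K that(2,3) \<C>(1)] that(1) by (intro cSUP_upper)
  have Hoelder: "?V r L \<le> ?V q L powr ?a * ?V s L powr ?b" if "L \<in> \<C>" for L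
    by (rule normalized_mixed_volume_log_convex[OF K L[OF that] order])
  have mono: "x powr c \<le> y powr c" if "0 \<le> x" "x \<le> y" "0 < c" for x y c :: real
    using that by (intro powr_mono2) auto
  from cases show ?thesis
  proof (elim disjE conjE)
    \<comment> \<open>Infima at r and s, a supremum at q: for each L the infimum at r is below its
      value at L, and L then varies in the factor for s only.\<close>
    assume "s < r" "r < 0" "0 < q" "q < real CARD('n)"
    have "(INF L\<in>\<C>. ?V r L) \<le> (SUP L\<in>\<C>. ?V q L) powr ?a * ?V s L powr ?b" if "L \<in> \<C>" for L
      using below[OF that] Hoelder[OF that] mult_right_mono[OF mono[OF nonneg above ab(1)] powr_ge_zero,
        OF that that \<open>0 < q\<close> \<open>q < real CARD('n)\<close>, of "?V s L" ?b]
      by (meson order.trans)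
    then have "(INF L\<in>\<C>. ?V r L) \<le> (SUP L\<in>\<C>. ?V q L) powr ?a * (INF L\<in>\<C>. ?V s L) powr ?b"
      using \<C>(2) nonneg ab by (intro le_powr_mult_cINF) auto
    then show ?thesis using \<open>s < r\<close> \<open>r < 0\<close> \<open>0 < q\<close> \<open>q < real CARD('n)\<close> by (simp add: INF SUP)
  next
    \<comment> \<open>All three extrema are suprema, so both factors are bounded separately,
      uniformly in L.\<close>
    assume "0 < s" "s < r" "r < q" "q < real CARD('n)"
    have "?V r L \<le> (SUP L\<in>\<C>. ?V q L) powr ?a * (SUP L\<in>\<C>. ?V s L) powr ?b" if "L \<in> \<C>" for L
      using \<open>0 < s\<close> \<open>s < r\<close> \<open>r < q\<close> \<open>q < real CARD('n)\<close> that nonneg[OF that] ab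
      by (intro order.trans[OF Hoelder] mult_mono mono above) auto
    then have "(SUP L\<in>\<C>. ?V r L) \<le> (SUP L\<in>\<C>. ?V q L) powr ?a * (SUP L\<in>\<C>. ?V s L) powr ?b"
      using \<C>(2) by (intro cSUP_least)
    then show ?thesis using \<open>0 < s\<close> \<open>s < r\<close> \<open>r < q\<close> \<open>q < real CARD('n)\<close> by (simp add: SUP)
  next
    \<comment> \<open>Infima at r and q, a supremum at s: the first case with the roles of q and s
      exchanged.\<close>
    assume "0 < s" "s < real CARD('n)" "real CARD('n) < r" "r < q"
    have "(INF L\<in>\<C>. ?V r L) \<le> (SUP L\<in>\<C>. ?V s L) powr ?b * ?V q L powr ?a" if "L \<in> \<C>" for L
      using below[OF that] Hoelder[OF that] mult_left_mono[OF mono[OF nonneg above ab(2)] powr_ge_zero,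
        OF that that \<open>0 < s\<close> \<open>s < real CARD('n)\<close>, of "?V q L" ?a]
      unfolding mult.commute[of _ "?V q L powr ?a"] by (meson order.trans)
    then have "(INF L\<in>\<C>. ?V r L) \<le> (SUP L\<in>\<C>. ?V s L) powr ?b * (INF L\<in>\<C>. ?V q L) powr ?a"
      using \<C>(2) nonneg ab by (intro le_powr_mult_cINF) auto
    then show ?thesis
      using \<open>0 < s\<close> \<open>s < real CARD('n)\<close> \<open>real CARD('n) < r\<close> \<open>r < q\<close>
      by (simp add: INF SUP mult.commute)
  qed
qed

theorem theorem4p3:
  fixes q r s :: real and K :: "(real ^ 'n) set"
  assumes "q \<noteq> real CARD('n)" "r \<noteq> real CARD('n)" "s \<noteq> real CARD('n)"
    and "(s < r \<and> r < 0 \<and> 0 < q \<and> q < real CARD('n)) \<or>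
         (0 < s \<and> s < r \<and> r < q \<and> q < real CARD('n)) \<or>
         (0 < s \<and> s < real CARD('n) \<and> real CARD('n) < r \<and> r < q)"
    and "K \<in> star_bodies"
  shows "G_orlicz r K \<le> G_orlicz q K powr ((r - s) / (q - s)) * G_orlicz s K powr ((q - r) / (q - s))
       \<and> Omega_orlicz r K \<le> Omega_orlicz q K powr ((r - s) / (q - s)) * Omega_orlicz s K powr ((q - r) / (q - s))"
proof
  \<comment> \<open>The unit ball is centered and its own polar, so it lies in both classes, and the
    extrema are over nonempty sets.\<close>
  have ball: "(cball 0 1 :: (real ^ 'n) set) \<in> K_tilde"
    using cball_in_centered_bodies by (auto simp: K_tilde_def)
  then have "(cball 0 1 :: (real ^ 'n) set) \<in> S_tilde"
    using cball_in_star_bodies by (simp add: S_tilde_def polar_cball)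
  then show "Omega_orlicz r K \<le> Omega_orlicz q K powr ((r - s) / (q - s)) * Omega_orlicz s K powr ((q - r) / (q - s))"
    unfolding Omega_orlicz_def using assms(4,5) by (intro orlicz_extremum_log_convex) auto
  show "G_orlicz r K \<le> G_orlicz q K powr ((r - s) / (q - s)) * G_orlicz s K powr ((q - r) / (q - s))"
    unfolding G_orlicz_def using ball assms(4,5) by (intro orlicz_extremum_log_convex) auto
qed

end
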